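(* Let $f:[0,\infty[\to\mathbb{R}$ be a càdlàg function. Then $f$ is Hunt-expandable if and only if $f$ is continuous and there exists $t_0\in[0,\infty]$ such that $t\mapsto f(t)$ is strictly monotone (increasing or decreasing) on $[0,t_0[$ and constant on $[t_0,\infty[$.
   Context: A deterministic (time homogeneous, universal) Markov process on $\mathbb{R}$ is a family $(X^x)_{x\in\mathbb{R}}$ of functions (paths) $t\mapsto X_t^x$, $[0,\infty[\to\mathbb{R}$, not depending on $\omega$, with $X_0^x=x$ for every $x$, such that: whenever $X_s^x=X_t^y$ for some $s,t\ge 0$ and $x,y\in\mathbb{R}$, then $X_{s+h}^x=X_{t+h}^y$ for every $h\ge 0$. All paths are assumed to be càdlàg (right-continuous with left limits). A deterministic Markov process is a deterministic Hunt process if in addition it is quasi-left continuous for every starting point, which for deterministic processes is equivalent to left continuity of all paths $t\mapsto X_t^x$. $f$ is Hunt-expandable if there exists a deterministic Hunt process $(X^x)_{x\in\mathbb{R}}$ with $X_t^{f(0)}=f(t)$ for every $t\ge0$. For $t_0=0$ the interval $[0,t_0[$ is empty and for $t_0=\infty$ the interval $[t_0,\infty[$ is empty. *)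

theory Defs
  imports "HOL-Analysis.Analysis"
begin

text \<open>Functions on \<open>[0,\<infinity>[\<close> are rendered as functions on \<^typ>\<open>real\<close> of which only the
  values at arguments \<open>t \<ge> 0\<close> are ever constrained.\<close>

definition cadlag :: "(real \<Rightarrow> real) \<Rightarrow> bool" where
  "cadlag g \<longleftrightarrow>
     (\<forall>t\<ge>0. continuous (at_right t) g) \<and>
     (\<forall>t>0. \<exists>l. (g \<longlongrightarrow> l) (at_left t))"

text \<open>\<open>X x t\<close> is the position at time \<open>t\<close> of the path started in \<open>x\<close>.\<close>

definition deterministic_markov_process :: "(real \<Rightarrow> real \<Rightarrow> real) \<Rightarrow> bool" where
  "deterministic_markov_process X \<longleftrightarrow>
     (\<forall>x. cadlag (X x)) \<and>
     (\<forall>x. X x 0 = x) \<and>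
     (\<forall>x y. \<forall>s\<ge>0. \<forall>t\<ge>0. X x s = X y t \<longrightarrow> (\<forall>h\<ge>0. X x (s + h) = X y (t + h)))"

text \<open>Quasi-left continuity asks that \<open>X\<^bsub>\<tau> n\<^esub> \<rightarrow> X\<^bsub>T\<^esub>\<close> almost surely on \<open>{T < \<infinity>}\<close> for all
  stopping times \<open>\<tau> n\<close> increasing to \<open>T\<close>.  For a process that does not depend on \<open>\<omega>\<close>, stopping
  times are almost surely constant, so it is a condition on increasing sequences of
  deterministic times.\<close>

definition quasi_left_continuous :: "(real \<Rightarrow> real) \<Rightarrow> bool" where
  "quasi_left_continuous g \<longleftrightarrow>
     (\<forall>\<tau> T. (\<forall>n. 0 \<le> \<tau> n) \<and> incseq \<tau> \<and> \<tau> \<longlonglongrightarrow> T \<longrightarrow> (\<lambda>n. g (\<tau> n)) \<longlonglongrightarrow> g T)"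

lemma quasi_left_continuous_iff_left_continuous:
  "quasi_left_continuous g \<longleftrightarrow> (\<forall>t>0. continuous (at_left t) g)"
proof
  assume q: "quasi_left_continuous g"
  show "\<forall>t>0. continuous (at_left t) g"
  proof (intro allI impI)
    fix t :: real assume t: "0 < t"
    have "(g \<longlongrightarrow> g t) (at_left t)"
    proof (rule tendsto_at_left_sequentially[OF t])
      fix S :: "nat \<Rightarrow> real"
      assume "\<And>n. S n < t" "\<And>n. 0 < S n" "incseq S" "S \<longlonglongrightarrow> t"
      then show "(\<lambda>n. g (S n)) \<longlonglongrightarrow> g t"
        using q unfolding quasi_left_continuous_def by (meson less_imp_le)
    qed
    then show "continuous (at_left t) g"
      by (simp add: continuous_within)
  qed
next
  assume l: "\<forall>t>0. continuous (at_left t) g"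
  show "quasi_left_continuous g"
    unfolding quasi_left_continuous_def
  proof (intro allI impI, elim conjE)
    fix \<tau> :: "nat \<Rightarrow> real" and T
    assume nonneg: "\<forall>n. 0 \<le> \<tau> n" and inc: "incseq \<tau>" and lim: "\<tau> \<longlonglongrightarrow> T"
    have le: "\<tau> n \<le> T" for n
      using inc lim by (rule incseq_le)
    show "(\<lambda>n. g (\<tau> n)) \<longlonglongrightarrow> g T"
    proof (cases "0 < T")
      case True
      then have "(g \<longlongrightarrow> g T) (at T within {..<T})"
        using l by (simp add: continuous_within)
      moreover have "{..T} = insert T {..<T}"
        by auto
      ultimately have "continuous (at T within {..T}) g"
        by (simp add: continuous_within Lim_within)
      then show ?thesis
        by (rule continuous_within_tendsto_compose') (use le lim in auto)
    next
      case False
      then have "\<tau> n = T" for n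
        using le[of n] nonneg[rule_format, of n] by linarith
      then show ?thesis by simp
    qed
  qed
qed

definition deterministic_hunt_process :: "(real \<Rightarrow> real \<Rightarrow> real) \<Rightarrow> bool" where
  "deterministic_hunt_process X \<longleftrightarrow>
     deterministic_markov_process X \<and> (\<forall>x. quasi_left_continuous (X x))"

lemma deterministic_hunt_process_iff_left_continuous:
  "deterministic_hunt_process X \<longleftrightarrow>
     deterministic_markov_process X \<and> (\<forall>x. \<forall>t>0. continuous (at_left t) (X x))"
  by (simp add: deterministic_hunt_process_def quasi_left_continuous_iff_left_continuous)

definition hunt_expandable :: "(real \<Rightarrow> real) \<Rightarrow> bool" where
  "hunt_expandable f \<longleftrightarrow>
     (\<exists>X. deterministic_hunt_process X \<and> (\<forall>t\<ge>0. X (f 0) t = f t))"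

end

theory Submission
  imports Defs
begin

text \<open>A continuous \<open>f\<close> is Hunt-expandable iff \<open>f s = f t\<close> always implies \<open>f (s + h) = f (t + h)\<close>:
  start the process along \<open>f\<close> at points in the range of \<open>f\<close> and let all other points be absorbing.
  If such an \<open>f\<close> is not injective, say \<open>f s = f t\<close> with \<open>s < t\<close>, it is \<open>(t - s)\<close>-periodic on
  \<open>[s,\<infinity>[\<close>.  For every \<open>d > 0\<close>, the function \<open>u \<mapsto> f (u + d) - f u\<close> is nonpositive at a maximum
  and nonnegative at a minimum of \<open>f\<close>, so it has a zero; hence \<open>f\<close> has every
  period \<open>d > 0\<close> and is constant.  So \<open>f\<close> is injective up to the infimum of
  the times at which it takes a value that it takes again later, and constant afterwards.\<close>

section \<open>Shift consistency and periodicity\<close>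

text \<open>This is the Markov condition of a process applied to a single path compared with itself
  at two times.\<close>

definition shift_consistent :: "(real \<Rightarrow> 'a) \<Rightarrow> bool" where
  "shift_consistent f \<longleftrightarrow> (\<forall>s\<ge>0. \<forall>t\<ge>0. f s = f t \<longrightarrow> (\<forall>h\<ge>0. f (s + h) = f (t + h)))"

lemma shift_consistentD:
  assumes "shift_consistent f" "0 \<le> s" "0 \<le> t" "f s = f t" "0 \<le> h"
  shows "f (s + h) = f (t + h)"
  using assms unfolding shift_consistent_def by blast

lemma periodic_add_multiple:
  fixes f :: "real \<Rightarrow> 'a"
  assumes "0 \<le> p" "\<And>u. s \<le> u \<Longrightarrow> f (u + p) = f u" "s \<le> u"
  shows "f (u + real n * p) = f u"
proof (induction n)
  case (Suc n)
  have "s \<le> u + real n * p"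
    using assms by (simp add: add_increasing2)
  then have "f (u + real n * p + p) = f (u + real n * p)"
    by (rule assms(2))
  with Suc show ?case by (simp add: algebra_simps)
qed simp

text \<open>Subtracting the \<open>n\<close> whole periods that fit between \<open>s\<close> and
  \<open>u\<close> lands in one closed period. This transfers extrema over that compact interval to
  the whole ray.\<close>

lemma periodic_on_ray_representative:
  fixes f :: "real \<Rightarrow> 'a"
  assumes "0 < p" "\<And>u. s \<le> u \<Longrightarrow> f (u + p) = f u" "s \<le> u"
  obtains v where "v \<in> {s..s + p}" "f v = f u"
proof -
  define n where "n = nat \<lfloor>(u - s) / p\<rfloor>"
  have "real n = of_int \<lfloor>(u - s) / p\<rfloor>"
    using assms by (simp add: n_def)
  then have "real n \<le> (u - s) / p" "(u - s) / p \<le> real n + 1"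
    by linarith+
  then have "real n * p \<le> u - s" "u - s \<le> real n * p + p"
    using assms(1) by (simp_all add: field_simps)
  then have v: "u - real n * p \<in> {s..s + p}"
    by simp
  then have "f (u - real n * p + real n * p) = f (u - real n * p)"
    using assms by (intro periodic_add_multiple[where s = s]) auto
  with v show thesis
    by (intro that[of "u - real n * p"]) auto
qed

lemma shift_consistent_imp_constant:
  fixes f :: "real \<Rightarrow> real"
  assumes cont: "continuous_on {0..} f" and sc: "shift_consistent f"
    and st: "0 \<le> s" "s < t" "f s = f t" and u: "s \<le> u"
  shows "f u = f s"
proof -
  define p where "p = t - s"
  have p: "0 < p" using st by (simp add: p_def)
  have per: "f (v + p) = f v" if "s \<le> v" for v
    using shift_consistentD[OF sc, of s t "v - s"] st that by (simp add: p_def algebra_simps)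
  have cont': "continuous_on {s..s + p} f"
    using cont by (rule continuous_on_subset) (use st in auto)
  obtain a where a: "a \<in> {s..s + p}" "\<And>v. v \<in> {s..s + p} \<Longrightarrow> f v \<le> f a"
    using continuous_attains_sup[OF _ _ cont'] p by auto
  obtain b where b: "b \<in> {s..s + p}" "\<And>v. v \<in> {s..s + p} \<Longrightarrow> f b \<le> f v"
    using continuous_attains_inf[OF _ _ cont'] p by auto
  \<comment> \<open>The shifted points \<open>a + d\<close> and \<open>b + d\<close> may leave the
    compact interval, so the extrema must be global on the ray.\<close>
  have bounds: "f b \<le> f v \<and> f v \<le> f a" if "s \<le> v" for v
    using periodic_on_ray_representative[of p s f v] p per that a(2) b(2) by metis
  have all_periods: "f (t + d) = f t" if d: "0 \<le> d" for d
  proof -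
    let ?g = "\<lambda>v. f (v + d) - f v"
    have "closed_segment a b \<subseteq> {s..t}"
      using a(1) b(1) by (auto simp: closed_segment_eq_real_ivl p_def split: if_splits)
    then have "continuous_on (closed_segment a b) ?g"
      using st d by (intro continuous_intros continuous_on_compose2[OF cont]) auto
    moreover have "0 \<in> closed_segment (?g a) (?g b)"
      using bounds[of "a + d"] bounds[of "b + d"] a(1) b(1) d
      by (auto simp: closed_segment_eq_real_ivl)
    ultimately obtain z where z: "z \<in> closed_segment a b" "?g z = 0"
      using IVT'_closed_segment_real[where f = ?g and a = a and b = b and y = 0] by blast
    then have "s \<le> z" "z \<le> t" "f (z + d) = f z"
      using \<open>closed_segment a b \<subseteq> {s..t}\<close> by auto
    \<comment> \<open>The position of the zero \<open>z\<close> is unknown, but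
      \<open>z \<le> t\<close>, so shifting both times by \<open>t - z\<close> moves the equality to
      \<open>t\<close>, the same point for every \<open>d\<close>.\<close>
    then show ?thesis
      using shift_consistentD[OF sc, of "z + d" z "t - z"] st d by (simp add: algebra_simps)
  qed
  \<comment> \<open>\<open>u\<close> may precede \<open>t\<close>, whereas \<open>u + p\<close> does
    not, so \<open>all_periods\<close> applies there.\<close>
  have "f u = f (u + p)"
    using per u by simp
  also have "\<dots> = f t"
    using all_periods[of "u + p - t"] u by (simp add: p_def algebra_simps)
  finally show ?thesis
    using st by simp
qed

section \<open>Injective up to a time, constant afterwards\<close>

text \<open>If the endpoint values agreed, a value strictly between them and the midpoint value
  would be taken on both sides of the midpoint, and at neither endpoint, contradicting
  injectivity.\<close>

lemma continuous_inj_on_right_open_neq_endpoint: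
  fixes f :: "real \<Rightarrow> real"
  assumes cont: "continuous_on {a..b} f" and inj: "inj_on f {a..<b}" and "a < b"
  shows "f a \<noteq> f b"
proof
  assume eq: "f a = f b"
  define m where "m = (a + b) / 2"
  have m: "a < m" "m < b" using \<open>a < b\<close> by (auto simp: m_def)
  then have neq: "f a \<noteq> f m"
    using inj_onD[OF inj, of a m] by auto
  define v where "v = (f a + f m) / 2"
  have v: "v \<noteq> f a" "v \<noteq> f m" "v \<in> closed_segment (f a) (f m)" "v \<in> closed_segment (f m) (f b)"
    using neq eq by (auto simp: v_def closed_segment_eq_real_ivl)
  obtain x where x: "x \<in> {a..m}" "f x = v"
    using IVT'_closed_segment_real[where f = f and a = a and b = m, OF v(3)] continuous_on_subset[OF cont, of "{a..m}"] m
    by (auto simp: closed_segment_eq_real_ivl)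
  obtain y where y: "y \<in> {m..b}" "f y = v"
    using IVT'_closed_segment_real[where f = f and a = m and b = b, OF v(4)] continuous_on_subset[OF cont, of "{m..b}"] m
    by (auto simp: closed_segment_eq_real_ivl)
  have "x \<noteq> m" "y \<noteq> m" "y \<noteq> b"
    using x y v eq by auto
  then have "x \<in> {a..<b}" "y \<in> {a..<b}" "x \<noteq> y"
    using x y m by auto
  then show False
    using inj_onD[OF inj, of x y] x y by auto
qed

lemma shift_consistent_iff_inj_then_constant:
  fixes f :: "real \<Rightarrow> real"
  assumes cont: "continuous_on {0..} f"
  shows "shift_consistent f \<longleftrightarrow>
    (\<exists>t0::ereal. 0 \<le> t0 \<and> inj_on f {t. 0 \<le> t \<and> ereal t < t0} \<and>
      f constant_on {t. 0 \<le> t \<and> t0 \<le> ereal t})"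
    (is "_ \<longleftrightarrow> (\<exists>t0. ?shape t0)")
proof
  assume sc: "shift_consistent f"
  define S where "S = {s. 0 \<le> s \<and> (\<exists>t>s. f s = f t)}"
  \<comment> \<open>For injective \<open>f\<close> the set \<open>S\<close> is empty and this
    infimum in \<open>ereal\<close> is infinite.\<close>
  define t0 where "t0 = Inf (ereal ` S)"
  have const: "f u = f s" if "s \<in> S" "s \<le> u" for s u
    using that shift_consistent_imp_constant[OF cont sc] unfolding S_def by blast
  have "0 \<le> t0"
    unfolding t0_def by (rule Inf_greatest) (auto simp: S_def)
  moreover have "inj_on f {t. 0 \<le> t \<and> ereal t < t0}"
  proof (rule linorder_inj_onI)
    fix s t assume "s < t" "s \<in> {t. 0 \<le> t \<and> ereal t < t0}"
    moreover from this have "s \<notin> S"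
      unfolding t0_def using Inf_lower[of "ereal s" "ereal ` S"] by (auto simp: not_less)
    ultimately show "f s \<noteq> f t"
      by (auto simp: S_def)
  qed auto
  moreover have "f constant_on {t. 0 \<le> t \<and> t0 \<le> ereal t}"
  proof -
    have "f u = f v" if uv: "0 \<le> u" "t0 \<le> ereal u" "u < v" for u v
    proof -
      \<comment> \<open>The infimum need not be attained at \<open>u\<close>, so constancy is first
        shown strictly to the right of \<open>u\<close>; right continuity then includes
        \<open>u\<close> itself.\<close>
      have after: "f w = f v" if "u < w" for w
      proof -
        obtain m where m: "u < m" "m < w" "m < v"
          using \<open>u < w\<close> uv(3) dense[of u "min w v"] by auto
        with uv have "Inf (ereal ` S) < ereal m"
          unfolding t0_def by (auto intro: le_less_trans)
        then obtain s where "s \<in> S" "s < m"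
          by (auto simp: Inf_less_iff)
        then show ?thesis
          using const[of s w] const[of s v] m by simp
      qed
      have "(f \<longlongrightarrow> f u) (at u within {0..})"
        using cont uv by (auto simp: continuous_on)
      then have "(f \<longlongrightarrow> f u) (at_right u)"
        by (rule tendsto_within_subset) (use uv in auto)
      moreover have "(f \<longlongrightarrow> f v) (at_right u)"
        using after by (intro tendsto_eventually) (auto simp: eventually_at_right_less eventually_at_filter)
      ultimately show ?thesis
        using tendsto_unique[OF trivial_limit_at_right_real] by blast
    qed
    then show ?thesis
      unfolding constant_on_def
      by (metis (mono_tags, lifting) linorder_less_linear mem_Collect_eq)
  qed
  ultimately show "\<exists>t0. ?shape t0"
    by blast
next
  assume "\<exists>t0. ?shape t0"
  then obtain t0 :: ereal where inj: "inj_on f {t. 0 \<le> t \<and> ereal t < t0}"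
    and const: "f constant_on {t. 0 \<le> t \<and> t0 \<le> ereal t}"
    by blast
  have eq: "f u = f v" if "0 \<le> u" "t0 \<le> ereal u" "0 \<le> v" "t0 \<le> ereal v" for u v
    using const that unfolding constant_on_def by auto
  \<comment> \<open>This forces times with equal values onto the same side of \<open>t0\<close>,
    where injectivity or constancy settles the claim. Here \<open>t0\<close> is finite, because it
    lies between two reals.\<close>
  have neq: "f s \<noteq> f t" if st: "0 \<le> s" "ereal s < t0" "t0 \<le> ereal t" for s t
  proof -
    obtain r where r: "t0 = ereal r" "s < r" "r \<le> t"
      using st by (cases t0) auto
    have "f s \<noteq> f r"
    proof (rule continuous_inj_on_right_open_neq_endpoint[where f = f and a = s and b = r])
      show "continuous_on {s..r} f"
        using cont by (rule continuous_on_subset) (use that in auto)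
      show "inj_on f {s..<r}"
        using inj by (rule inj_on_subset) (use that r in auto)
    qed (rule r(2))
    with eq[of r t] r that show ?thesis by simp
  qed
  have "f (s + h) = f (t + h)" if "0 \<le> s" "0 \<le> t" "f s = f t" "0 \<le> h" for s t h
  proof (cases "ereal s < t0 \<or> ereal t < t0")
    case True
    with that neq[of s t] neq[of t s] have "ereal s < t0 \<and> ereal t < t0"
      by (metis not_less)
    with that inj_onD[OF inj, of s t] show ?thesis
      by simp
  next
    case False
    moreover have "ereal s \<le> ereal (s + h)" "ereal t \<le> ereal (t + h)"
      using that by auto
    ultimately show ?thesis
      using that by (intro eq) (auto simp: not_less intro: order_trans)
  qed
  then show "shift_consistent f"
    unfolding shift_consistent_def by blast
qed

section \<open>Continuity on the ray and the expanding process\<close>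

lemma continuous_on_ray_iff_one_sided:
  fixes f :: "real \<Rightarrow> 'a::topological_space"
  shows "continuous_on {a..} f \<longleftrightarrow>
    (\<forall>t\<ge>a. continuous (at_right t) f) \<and> (\<forall>t>a. continuous (at_left t) f)"
proof -
  have "continuous (at t within {a..}) f \<longleftrightarrow>
      continuous (at_right t) f \<and> (t > a \<longrightarrow> continuous (at_left t) f)" if "t \<ge> a" for t
  proof (cases "t = a")
    case True
    then show ?thesis
      by (simp add: continuous_within at_within_Ici_at_right)
  next
    case False
    with that have "t > a" by simp
    then have "at t within {a..} = at t"
      by (intro at_within_interior) auto
    with \<open>t > a\<close> show ?thesis
      by (auto simp: continuous_within filterlim_at_split)
  qed
  then show ?thesis
    by (auto simp: continuous_on_eq_continuous_within)
qed

lemma cadlag_if_continuous_on: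
  assumes "continuous_on {0..} g"
  shows "cadlag g"
  using assms unfolding continuous_on_ray_iff_one_sided cadlag_def
  by (auto simp: continuous_within)

text \<open>Right continuity from \<open>cadlag\<close> and left continuity combine to continuity on
  the ray, which in turn yields the left limits.\<close>

lemma deterministic_hunt_process_iff_continuous_on:
  "deterministic_hunt_process X \<longleftrightarrow>
     (\<forall>x. continuous_on {0..} (X x)) \<and> (\<forall>x. X x 0 = x) \<and>
     (\<forall>x y. \<forall>s\<ge>0. \<forall>t\<ge>0. X x s = X y t \<longrightarrow> (\<forall>h\<ge>0. X x (s + h) = X y (t + h)))"
proof -
  have "cadlag g \<and> (\<forall>t>0. continuous (at_left t) g) \<longleftrightarrow> continuous_on {0..} g" for g
    using cadlag_if_continuous_on[of g]
    by (auto simp: continuous_on_ray_iff_one_sided cadlag_def)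
  then have "(\<forall>x. continuous_on {0..} (X x)) \<longleftrightarrow>
      (\<forall>x. cadlag (X x)) \<and> (\<forall>x. \<forall>t>0. continuous (at_left t) (X x))"
    by metis
  then show ?thesis
    unfolding deterministic_hunt_process_iff_left_continuous deterministic_markov_process_def
    by (simp only: conj_ac)
qed

lemma hunt_expandable_iff:
  "hunt_expandable f \<longleftrightarrow> continuous_on {0..} f \<and> shift_consistent f"
proof
  assume "hunt_expandable f"
  then obtain X where X: "deterministic_hunt_process X" "\<And>t. t \<ge> 0 \<Longrightarrow> X (f 0) t = f t"
    unfolding hunt_expandable_def by blast
  from X have "continuous_on {0..} (X (f 0))"
    by (simp add: deterministic_hunt_process_iff_continuous_on)
  then have "continuous_on {0..} f"
    by (rule continuous_on_eq) (simp add: X)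
  moreover have "f (s + h) = f (t + h)" if "0 \<le> s" "0 \<le> t" "f s = f t" "0 \<le> h" for s t h
  proof -
    have "X (f 0) s = X (f 0) t"
      using that by (simp add: X)
    then have "X (f 0) (s + h) = X (f 0) (t + h)"
      using X(1) that unfolding deterministic_hunt_process_iff_continuous_on by blast
    with X(2) that show ?thesis by simp
  qed
  ultimately show "continuous_on {0..} f \<and> shift_consistent f"
    unfolding shift_consistent_def by blast
next
  assume f: "continuous_on {0..} f \<and> shift_consistent f"
  \<comment> \<open>\<open>\<tau> x\<close> is an arbitrarily chosen time at which \<open>f\<close>
    takes the value \<open>x\<close>; by shift consistency the choice does not affect the
    future.\<close>
  define \<tau> where "\<tau> = inv_into {0..} f"
  define X where "X x t = (if x \<in> f ` {0..} then f (\<tau> x + t) else x)" for x t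
  have \<tau>: "0 \<le> \<tau> x" "f (\<tau> x) = x" if "x \<in> f ` {0..}" for x
    using inv_into_into[OF that] f_inv_into_f[OF that] by (auto simp: \<tau>_def)
  \<comment> \<open>No path enters or leaves the range of \<open>f\<close>, so two paths that meet
    are either both along \<open>f\<close> or both absorbed.\<close>
  have in_range: "X x t \<in> f ` {0..} \<longleftrightarrow> x \<in> f ` {0..}" if "0 \<le> t" for x t
    using that \<tau>(1) by (auto simp: X_def)
  have "continuous_on {0..} (X x)" for x
  proof (cases "x \<in> f ` {0..}")
    case True
    have "continuous_on {0..} (\<lambda>t. f (\<tau> x + t))"
      by (rule continuous_on_compose2[OF conjunct1[OF f]])
        (use \<tau>(1)[OF True] in \<open>auto intro!: continuous_intros\<close>)
    with True show ?thesis by (simp add: X_def)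
  qed (simp add: X_def)
  moreover have "X x 0 = x" for x
    using \<tau>(2) by (simp add: X_def)
  moreover have "X x (s + h) = X y (t + h)"
    if "0 \<le> s" "0 \<le> t" "X x s = X y t" "0 \<le> h" for x y s t h
  proof (cases "x \<in> f ` {0..}")
    case True
    with that have y: "y \<in> f ` {0..}"
      using in_range by metis
    have "f (\<tau> x + s) = f (\<tau> y + t)"
      using that True y by (simp add: X_def)
    then have "f (\<tau> x + s + h) = f (\<tau> y + t + h)"
      using f \<tau>(1) True y that by (intro shift_consistentD) auto
    with True y show ?thesis
      by (simp add: X_def add.assoc)
  next
    case False
    with that have "y \<notin> f ` {0..}"
      using in_range by metis
    with False that show ?thesis
      by (simp add: X_def)
  qed
  ultimately have "deterministic_hunt_process X"
    unfolding deterministic_hunt_process_iff_continuous_on by blast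
  \<comment> \<open>\<open>\<tau> (f 0)\<close> may differ from 0, but \<open>f\<close> has the same
    value at both times and hence the same future.\<close>
  moreover have "X (f 0) t = f t" if "0 \<le> t" for t
    using shift_consistentD[of f "\<tau> (f 0)" 0 t] f \<tau>[of "f 0"] that by (simp add: X_def)
  ultimately show "hunt_expandable f"
    unfolding hunt_expandable_def by blast
qed

theorem corollary2p8:
  fixes f :: "real \<Rightarrow> real"
  assumes "cadlag f"
  shows "hunt_expandable f \<longleftrightarrow>
    continuous_on {0..} f \<and>
    (\<exists>t0::ereal. 0 \<le> t0 \<and>
      (strict_mono_on {t. 0 \<le> t \<and> ereal t < t0} f \<or>
       strict_antimono_on {t. 0 \<le> t \<and> ereal t < t0} f) \<and>
      f constant_on {t. 0 \<le> t \<and> t0 \<le> ereal t})"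
proof (cases "continuous_on {0..} f")
  case True
  \<comment> \<open>On an interval, a continuous real function is injective exactly when it is
    strictly monotone.\<close>
  have "inj_on f {t. 0 \<le> t \<and> ereal t < t0} \<longleftrightarrow>
      strict_mono_on {t. 0 \<le> t \<and> ereal t < t0} f \<or>
      strict_antimono_on {t. 0 \<le> t \<and> ereal t < t0} f" for t0
  proof (rule injective_eq_monotone_map)
    show "is_interval {t. 0 \<le> t \<and> ereal t < t0}"
      unfolding is_interval_1 by auto (meson ereal_less_eq(3) le_less_trans)
    show "continuous_on {t. 0 \<le> t \<and> ereal t < t0} f"
      using True by (rule continuous_on_subset) auto
  qed
  with True show ?thesis
    by (simp add: hunt_expandable_iff shift_consistent_iff_inj_then_constant)
qed (simp add: hunt_expandable_iff)

end
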